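(* Let $\varepsilon>0$ and let $[x,y,z]^T\in\mathbb{R}^3$ with $[x,y,z]^T\notin G^\varepsilon$. Let $C\subset\mathbb{R}^3$ be the set consisting exactly of the following candidate points $[\rho,m,E]^T$: 1. $[\varepsilon,y,z]^T$, if $x<\varepsilon$ and $z-\frac{y^2}{2\varepsilon}\ge\varepsilon$. 2. $[\varepsilon,0,\varepsilon]^T$, if $x<\varepsilon$, $y=0$ and $z<\varepsilon$. 3. If $y\ne0$: for each real root $m_r$ of the cubic equation $m^3+(4\varepsilon^2-2\varepsilon z)m-2\varepsilon^2y=0$, the point $[\varepsilon,m_r,\frac{m_r^2}{2\varepsilon}+\varepsilon]^T$, provided $\frac{y}{m_r}>1$ and $2\varepsilon x+m_r(y-m_r)<2\varepsilon^2$. 4. $[x,0,\varepsilon]^T$, if $x\ge\varepsilon$, $y=0$ and $z<\varepsilon$. 5. For each of the two values $$\rho_{1},\rho_{2}=\frac{x}{2}\pm\frac12\,\frac{\sqrt{x^2\big(2y^2+(\varepsilon+x-z)^2\big)-2xy^2(z-\varepsilon)+y^4}}{\sqrt{2y^2+(\varepsilon+x-z)^2}}$$ (considered only if well defined and real), and for each of the two values $$m_1(\rho_j),\,m_2(\rho_j)=\frac y2\mp\frac12\sqrt{-8\rho_j^2+8x\rho_j+y^2}$$ (considered only if real), the point $\big[\rho_j,\,m_k(\rho_j),\,\varepsilon+\frac{m_k(\rho_j)^2}{2\rho_j}\big]^T$ ($j,k\in\{1,2\}$), provided $\rho_j\ge\varepsilon$ and $\varepsilon+\frac{m_k(\rho_j)^2}{2\rho_j}>z$.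 Then there is a point of $C$ minimizing $|\rho-x|^2+|m-y|^2+|E-z|^2$ over all $[\rho,m,E]^T\in C$, and such a point is the Euclidean projection of $[x,y,z]^T$ onto $G^\varepsilon$.
   Context: Here $G^\varepsilon=\{[\rho,m,E]^T\in\mathbb{R}^3:\ \rho\ge\varepsilon,\ E-\frac{m^2}{2\rho}\ge\varepsilon\}$, a closed convex set. The Euclidean projection of a point onto $G^\varepsilon$ is the unique point of $G^\varepsilon$ at minimal Euclidean distance from it. *)

theory Defs
  imports "HOL-Analysis.Analysis"
begin

text \<open>A point \<open>p :: real^3\<close> is the column \<open>[\<rho>, m, E]\<close>, with \<open>\<rho> = p $ 1\<close>, \<open>m = p $ 2\<close>, \<open>E = p $ 3\<close>.\<close>

definition G_set :: "real \<Rightarrow> (real^3) set" where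
  "G_set \<epsilon> = {p. p $ 1 \<ge> \<epsilon> \<and> p $ 3 - (p $ 2)\<^sup>2 / (2 * p $ 1) \<ge> \<epsilon>}"

lemma G_set_altdef:
  assumes "\<epsilon> > 0"
  shows "G_set \<epsilon> = {p. \<epsilon> \<le> p $ 1} \<inter> {p. (p $ 2)\<^sup>2 \<le> 2 * p $ 1 * (p $ 3 - \<epsilon>)}"
  using assms by (auto simp: G_set_def field_simps)

lemma closed_G_set:
  assumes "\<epsilon> > 0"
  shows "closed (G_set \<epsilon>)"
  unfolding G_set_altdef[OF assms]
  by (intro closed_Int closed_Collect_le continuous_intros)

lemma G_set_nonempty: "G_set \<epsilon> \<noteq> {}"
proof -
  have "vector [\<epsilon>, 0, \<epsilon>] \<in> G_set \<epsilon>" by (simp add: G_set_def)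
  then show ?thesis by blast
qed

lemma convex_G_set:
  assumes "\<epsilon> > 0"
  shows "convex (G_set \<epsilon>)"
proof (rule convexI)
  fix p q :: "real^3" and u v :: real
  assume p: "p \<in> G_set \<epsilon>" and q: "q \<in> G_set \<epsilon>" and uv: "0 \<le> u" "0 \<le> v" "u + v = 1"
  define a b c d e f where "a = p $ 1" "b = p $ 2" "c = p $ 3 - \<epsilon>" "d = q $ 1" "e = q $ 2" "f = q $ 3 - \<epsilon>"
  note defs = this
  have P: "\<epsilon> \<le> a" "b\<^sup>2 \<le> 2 * a * c" and Q: "\<epsilon> \<le> d" "e\<^sup>2 \<le> 2 * d * f"
    using p q unfolding G_set_altdef[OF assms] defs by auto
  have pos: "a > 0" "d > 0" using P Q assms by auto
  have e1: "b\<^sup>2 / a \<le> 2 * c" "e\<^sup>2 / d \<le> 2 * f" using P Q pos by (auto simp: field_simps)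
  have "2 * b * e \<le> d * (b\<^sup>2 / a) + a * (e\<^sup>2 / d)"
  proof -
    have "0 \<le> (d * b - a * e)\<^sup>2 / (a * d)" using pos by simp
    also have "\<dots> = d * (b\<^sup>2 / a) + a * (e\<^sup>2 / d) - 2 * b * e"
      using pos by (simp add: field_simps power2_eq_square)
    finally show ?thesis by simp
  qed
  also have "\<dots> \<le> d * (2 * c) + a * (2 * f)"
    using e1 pos by (intro add_mono mult_left_mono) auto
  finally have cross: "b * e \<le> d * c + a * f" by simp
  have "(u * b + v * e)\<^sup>2 = u\<^sup>2 * b\<^sup>2 + v\<^sup>2 * e\<^sup>2 + 2 * (u * v) * (b * e)"
    by (simp add: power2_eq_square algebra_simps)
  also have "\<dots> \<le> u\<^sup>2 * (2 * a * c) + v\<^sup>2 * (2 * d * f) + 2 * (u * v) * (d * c + a * f)"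
    using P Q cross uv by (intro add_mono mult_left_mono) auto
  also have "\<dots> = 2 * (u * a + v * d) * (u * c + v * f)"
    by (simp add: power2_eq_square algebra_simps)
  finally have main: "(u * b + v * e)\<^sup>2 \<le> 2 * (u * a + v * d) * (u * c + v * f)" .
  have eps: "\<epsilon> = u * \<epsilon> + v * \<epsilon>" using uv by (metis mult.commute mult.right_neutral distrib_left)
  have "\<epsilon> \<le> u * a + v * d"
    using P Q uv by (subst eps) (intro add_mono mult_left_mono; simp)
  moreover have "u * c + v * f = (u * p $ 3 + v * q $ 3) - \<epsilon>"
    using eps by (simp add: defs algebra_simps)
  ultimately show "u *\<^sub>R p + v *\<^sub>R q \<in> G_set \<epsilon>"
    using main unfolding G_set_altdef[OF assms] by (simp add: defs)
qed

text \<open>Hence \<^const>\<open>closest_point\<close>, a Hilbert choice in general, is the Euclidean projection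
  onto \<open>G_set \<epsilon>\<close>.\<close>

lemma closest_point_G_set_iff:
  assumes "\<epsilon> > 0"
  shows "p = closest_point (G_set \<epsilon>) a \<longleftrightarrow> p \<in> G_set \<epsilon> \<and> (\<forall>q\<in>G_set \<epsilon>. dist a p \<le> dist a q)"
  using closest_point_unique[OF convex_G_set[OF assms] closed_G_set[OF assms]]
    closest_point_exists[OF closed_G_set[OF assms] G_set_nonempty] by blast

definition cand1 :: "real \<Rightarrow> real \<Rightarrow> real \<Rightarrow> real \<Rightarrow> (real^3) set" where
  "cand1 \<epsilon> x y z =
    (if x < \<epsilon> \<and> z - y\<^sup>2 / (2 * \<epsilon>) \<ge> \<epsilon> then {vector [\<epsilon>, y, z]} else {})"

definition cand2 :: "real \<Rightarrow> real \<Rightarrow> real \<Rightarrow> real \<Rightarrow> (real^3) set" where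
  "cand2 \<epsilon> x y z =
    (if x < \<epsilon> \<and> y = 0 \<and> z < \<epsilon> then {vector [\<epsilon>, 0, \<epsilon>]} else {})"

text \<open>For \<open>\<epsilon> > 0\<close> and \<open>y \<noteq> 0\<close> the cubic does not vanish at \<open>0\<close>, so \<open>y / m\<close> is a genuine quotient.\<close>

definition cand3 :: "real \<Rightarrow> real \<Rightarrow> real \<Rightarrow> real \<Rightarrow> (real^3) set" where
  "cand3 \<epsilon> x y z =
    {vector [\<epsilon>, m, m\<^sup>2 / (2 * \<epsilon>) + \<epsilon>] | m.
       y \<noteq> 0 \<and>
       m ^ 3 + (4 * \<epsilon>\<^sup>2 - 2 * \<epsilon> * z) * m - 2 * \<epsilon>\<^sup>2 * y = 0 \<and>
       y / m > 1 \<and>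
       2 * \<epsilon> * x + m * (y - m) < 2 * \<epsilon>\<^sup>2}"

definition cand4 :: "real \<Rightarrow> real \<Rightarrow> real \<Rightarrow> real \<Rightarrow> (real^3) set" where
  "cand4 \<epsilon> x y z =
    (if x \<ge> \<epsilon> \<and> y = 0 \<and> z < \<epsilon> then {vector [x, 0, \<epsilon>]} else {})"

definition rho_num :: "real \<Rightarrow> real \<Rightarrow> real \<Rightarrow> real \<Rightarrow> real" where
  "rho_num \<epsilon> x y z = x\<^sup>2 * (2 * y\<^sup>2 + (\<epsilon> + x - z)\<^sup>2) - 2 * x * y\<^sup>2 * (z - \<epsilon>) + y ^ 4"

definition rho_den :: "real \<Rightarrow> real \<Rightarrow> real \<Rightarrow> real \<Rightarrow> real" where
  "rho_den \<epsilon> x y z = 2 * y\<^sup>2 + (\<epsilon> + x - z)\<^sup>2"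

text \<open>Since Isabelle's division and \<^const>\<open>sqrt\<close> are total, the provisos that the values are
  well defined and real become explicit conditions on denominators and radicands.\<close>

definition rho_values :: "real \<Rightarrow> real \<Rightarrow> real \<Rightarrow> real \<Rightarrow> real set" where
  "rho_values \<epsilon> x y z =
    (if rho_den \<epsilon> x y z \<noteq> 0 \<and> rho_num \<epsilon> x y z \<ge> 0
     then {x / 2 + 1 / 2 * (sqrt (rho_num \<epsilon> x y z) / sqrt (rho_den \<epsilon> x y z)),
           x / 2 - 1 / 2 * (sqrt (rho_num \<epsilon> x y z) / sqrt (rho_den \<epsilon> x y z))}
     else {})"

definition m_values :: "real \<Rightarrow> real \<Rightarrow> real \<Rightarrow> real set" where
  "m_values x y \<rho> =
    (if - 8 * \<rho>\<^sup>2 + 8 * x * \<rho> + y\<^sup>2 \<ge> 0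
     then {y / 2 - 1 / 2 * sqrt (- 8 * \<rho>\<^sup>2 + 8 * x * \<rho> + y\<^sup>2),
           y / 2 + 1 / 2 * sqrt (- 8 * \<rho>\<^sup>2 + 8 * x * \<rho> + y\<^sup>2)}
     else {})"

definition cand5 :: "real \<Rightarrow> real \<Rightarrow> real \<Rightarrow> real \<Rightarrow> (real^3) set" where
  "cand5 \<epsilon> x y z =
    {vector [\<rho>, m, \<epsilon> + m\<^sup>2 / (2 * \<rho>)] | \<rho> m.
       \<rho> \<in> rho_values \<epsilon> x y z \<and> m \<in> m_values x y \<rho> \<and>
       \<rho> \<ge> \<epsilon> \<and> \<epsilon> + m\<^sup>2 / (2 * \<rho>) > z}"

definition candidates :: "real \<Rightarrow> real \<Rightarrow> real \<Rightarrow> real \<Rightarrow> (real^3) set" where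
  "candidates \<epsilon> x y z =
    cand1 \<epsilon> x y z \<union> cand2 \<epsilon> x y z \<union> cand3 \<epsilon> x y z \<union> cand4 \<epsilon> x y z \<union> cand5 \<epsilon> x y z"

definition sq_dist :: "real \<Rightarrow> real \<Rightarrow> real \<Rightarrow> real^3 \<Rightarrow> real" where
  "sq_dist x y z p = \<bar>p $ 1 - x\<bar>\<^sup>2 + \<bar>p $ 2 - y\<bar>\<^sup>2 + \<bar>p $ 3 - z\<bar>\<^sup>2"

end

theory Submission
  imports Defs
begin

text \<open>
  All candidates lie in \<open>G_set \<epsilon>\<close>, so it is enough that the projection
  \<open>p = [r, m, e]\<close> of \<open>[x, y, z]\<close> is itself one of them: the projection minimizes the
  distance even over the larger set \<open>G_set \<epsilon>\<close>, and it is the only point of that set to do so.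

  Membership follows from the optimality (KKT) conditions
  \<open>p - [x, y, z] = \<lambda> [1, 0, 0] + \<mu> [m^2 / (2 r^2), - m / r, 1]\<close> with \<open>\<lambda>, \<mu> \<ge> 0\<close>, the two
  vectors being the gradients of \<open>r\<close> and \<open>e - m^2 / (2 r)\<close>, both constrained to be \<open>\<ge> \<epsilon>\<close>. The
  multipliers are thus \<open>\<mu> = e - z\<close> and \<open>\<lambda> = r - x - \<mu> m^2 / (2 r^2)\<close>, and \<open>projection_kkt\<close> (where
  \<open>\<lambda>\<close> is called \<open>\<nu>\<close>) obtains their signs and complementarity from the variational inequality of
  projections onto convex sets, tested at a few well-chosen points of \<open>G_set \<epsilon>\<close>.

  The candidates are the solutions of this system, sorted by active constraints. If \<open>\<mu> = 0\<close>, the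
  displacement is along \<open>[1, 0, 0]\<close> and not zero, so \<open>r = \<epsilon>\<close> and \<open>p = [\<epsilon>, y, z]\<close> (first family). Let \<open>\<mu> > 0\<close>. If \<open>y = 0\<close>, then
  \<open>m = 0\<close> and the second and fourth families arise. If \<open>y \<noteq> 0\<close> and \<open>\<lambda> > 0\<close>, then \<open>r = \<epsilon>\<close> and
  eliminating \<open>\<mu>\<close> yields the cubic for \<open>m\<close> (third family). If \<open>y \<noteq> 0\<close> and \<open>\<lambda> = 0\<close>, eliminating
  \<open>\<mu>\<close> yields \<open>m^2 - y m + 2 r (r - x) = 0\<close>, and eliminating \<open>m\<close> as well leaves the quadratic
  equation \<open>(2 r - x)^2 * rho_den \<epsilon> x y z = rho_num \<epsilon> x y z\<close> for \<open>r\<close> (fifth family).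
\<close>

section \<open>Optimality conditions for the projection\<close>

lemma vector3_in_G_set_iff:
  "(vector [r, m, e] :: real^3) \<in> G_set \<epsilon> \<longleftrightarrow> \<epsilon> \<le> r \<and> \<epsilon> + m\<^sup>2 / (2 * r) \<le> e"
  by (auto simp: G_set_def vector_3)

lemma projection_variational:
  fixes a :: "real^3"
  assumes "\<epsilon> > 0" and "\<epsilon> \<le> r" and "\<epsilon> + m\<^sup>2 / (2 * r) \<le> e"
  defines "p \<equiv> closest_point (G_set \<epsilon>) a"
  shows "0 \<le> (p $ 1 - a $ 1) * (r - p $ 1) + (p $ 2 - a $ 2) * (m - p $ 2)
             + (p $ 3 - a $ 3) * (e - p $ 3)"
proof -
  have "(a - p) \<bullet> (vector [r, m, e] - p) \<le> 0"
    unfolding p_def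
    using assms by (intro closest_point_dot convex_G_set closed_G_set)
      (auto simp: vector3_in_G_set_iff)
  then show ?thesis
    by (simp add: inner_vec_def sum_3 vector_3 algebra_simps)
qed

text \<open>A vertical step upwards gives \<open>\<mu> \<ge> 0\<close>, and one downwards to the surface
  \<open>e = \<epsilon> + m^2 / (2 r)\<close> gives complementarity. If \<open>\<mu> = 0\<close>, heights do not enter the variational
  inequality, so \<open>m\<close> and \<open>r\<close> can be varied separately. If \<open>\<mu> > 0\<close>, the step in \<open>m\<close> follows the
  parabola of fixed \<open>r\<close>. The step in \<open>r\<close> follows the ray from \<open>[0, 0, \<epsilon>]\<close>: the surface is a cone
  with that apex, so the ray remains on it and the inequality is linear in the step.\<close>

lemma projection_kkt:
  fixes a :: "real^3"
  assumes eps: "\<epsilon> > 0"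
  defines "p \<equiv> closest_point (G_set \<epsilon>) a"
  obtains \<mu> \<nu> where "\<epsilon> \<le> p $ 1" "\<epsilon> + (p $ 2)\<^sup>2 / (2 * p $ 1) \<le> p $ 3"
    and "p $ 3 - a $ 3 = \<mu>" "0 \<le> \<mu>" "0 < \<mu> \<Longrightarrow> p $ 3 = \<epsilon> + (p $ 2)\<^sup>2 / (2 * p $ 1)"
    and "p $ 2 - a $ 2 = - \<mu> * p $ 2 / p $ 1"
    and "p $ 1 - a $ 1 = \<nu> + \<mu> * (p $ 2)\<^sup>2 / (2 * (p $ 1)\<^sup>2)" "0 \<le> \<nu>"
      "\<epsilon> < p $ 1 \<Longrightarrow> \<nu> = 0"
proof -
  define r m e where "r = p $ 1" and "m = p $ 2" and "e = p $ 3"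
  define u v \<mu> where "u = r - a $ 1" and "v = m - a $ 2" and "\<mu> = e - a $ 3"
  define \<nu> where "\<nu> = u - \<mu> * m\<^sup>2 / (2 * r\<^sup>2)"
  have "p \<in> G_set \<epsilon>"
    unfolding p_def by (rule closest_point_in_set[OF closed_G_set[OF eps] G_set_nonempty])
  then have r: "\<epsilon> \<le> r" and e: "\<epsilon> + m\<^sup>2 / (2 * r) \<le> e"
    by (auto simp: G_set_def r_def m_def e_def)
  have r0: "0 < r" using r eps by simp
  have vi: "0 \<le> u * (r' - r) + v * (m' - m) + \<mu> * (e' - e)"
    if "\<epsilon> \<le> r'" "\<epsilon> + m'\<^sup>2 / (2 * r') \<le> e'" for r' m' e'
    using projection_variational[OF eps that, of a]
    by (simp add: u_def v_def \<mu>_def r_def m_def e_def p_def)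
  have mu0: "0 \<le> \<mu>"
    using vi[of r m "e + 1"] r e by simp
  have surf: "e = \<epsilon> + m\<^sup>2 / (2 * r)" if "0 < \<mu>"
  proof -
    have "0 \<le> \<mu> * (\<epsilon> + m\<^sup>2 / (2 * r) - e)"
      using vi[of r m "\<epsilon> + m\<^sup>2 / (2 * r)"] r by simp
    with that e show ?thesis by (simp add: zero_le_mult_iff)
  qed
  have v: "v = - \<mu> * m / r"
  proof (cases "\<mu> = 0")
    case True
    have "0 \<le> - v\<^sup>2"
      using vi[of r "m - v" "\<epsilon> + (m - v)\<^sup>2 / (2 * r)"] r True by (simp add: power2_eq_square)
    then show ?thesis using True by simp
  next
    case False
    then have mu: "0 < \<mu>" using mu0 by simp
    define b where "b = v + \<mu> * m / r"
    \<comment> \<open>the minimizer of the quadratic \<open>b * t + \<mu> * t^2 / (2 * r)\<close>, whose minimum is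
      \<open>- r * b^2 / (2 * \<mu>)\<close>\<close>
    define t where "t = - (r * b / \<mu>)"
    have "0 \<le> v * t + \<mu> * ((m + t)\<^sup>2 / (2 * r) - m\<^sup>2 / (2 * r))"
      using vi[of r "m + t" "\<epsilon> + (m + t)\<^sup>2 / (2 * r)"] r surf[OF mu] by simp
    also have "\<dots> = b * t + \<mu> * t\<^sup>2 / (2 * r)"
      using r0 by (simp add: b_def field_simps power2_eq_square)
    also have "\<dots> = - (r * b\<^sup>2 / (2 * \<mu>))"
      using r0 mu by (simp add: t_def field_simps power2_eq_square)
    finally have "r * b\<^sup>2 / (2 * \<mu>) \<le> 0" by simp
    then have "b\<^sup>2 \<le> 0" using r0 mu by (simp add: field_simps mult_le_0_iff)
    then show ?thesis using r0 by (simp add: b_def field_simps)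
  qed
  have ray: "0 \<le> (r' - r) * \<nu>" if r': "\<epsilon> \<le> r'" for r'
  proof (cases "\<mu> = 0")
    case True
    have "0 \<le> u * (r' - r)"
      using vi[of r' m "\<epsilon> + m\<^sup>2 / (2 * r')"] r' True v by simp
    then show ?thesis using True by (simp add: \<nu>_def mult.commute)
  next
    case False
    then have mu: "0 < \<mu>" using mu0 by simp
    have r'0: "0 < r'" using r' eps by simp
    have "0 \<le> u * (r' - r) + v * (m * r' / r - m)
        + \<mu> * ((m * r' / r)\<^sup>2 / (2 * r') - m\<^sup>2 / (2 * r))"
      using vi[of r' "m * r' / r" "\<epsilon> + (m * r' / r)\<^sup>2 / (2 * r')"] r' surf[OF mu] by simp
    also have "\<dots> = (r' - r) * \<nu>"
      using r0 r'0 by (simp add: v \<nu>_def field_simps power2_eq_square)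
    finally show ?thesis .
  qed
  have "0 \<le> \<nu>"
    using ray[of "r + 1"] r by simp
  moreover have "\<nu> = 0" if "\<epsilon> < r"
    using ray[of \<epsilon>] that \<open>0 \<le> \<nu>\<close> by (simp add: zero_le_mult_iff)
  ultimately show thesis
    by (intro that[of \<mu> \<nu>])
      (use r e mu0 surf v in \<open>auto simp: u_def v_def \<mu>_def \<nu>_def r_def m_def e_def\<close>)
qed

section \<open>Solving the optimality conditions\<close>

text \<open>Because \<open>(2 r - x)^2 - x^2 = 4 r (r - x)\<close>, the claim amounts to
  \<open>4 r (r - x) rho_den = y^2 (y^2 - 2 x (z - \<epsilon>))\<close>. In the parameters \<open>r, m, \<mu>\<close> the factor
  \<open>rho_den\<close> is the square \<open>(1 + \<mu> / r)^2 (r + m^2 / (2 r))^2\<close>, and both sides equal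
  \<open>(2 \<mu> m^2 / r) rho_den\<close>.\<close>

lemma kkt_rho_equation:
  fixes r m \<mu> \<epsilon> :: real
  assumes "r \<noteq> 0"
    and x: "x = r - \<mu> * m\<^sup>2 / (2 * r\<^sup>2)"
    and y: "y = m + \<mu> * m / r"
    and z: "z = \<epsilon> + m\<^sup>2 / (2 * r) - \<mu>"
  shows "(2 * r - x)\<^sup>2 * rho_den \<epsilon> x y z = rho_num \<epsilon> x y z"
proof -
  \<comment> \<open>Rescaling by \<open>r\<close> turns the identity into a polynomial one, and the factor \<open>2\<close> in \<open>n\<close>
    gives it integer coefficients.\<close>
  define k n where "k = \<mu> / r" and "n = m / (2 * r)"
  have eqs: "x = r * (1 - 2 * k * n\<^sup>2)" "y = r * (2 * n * (1 + k))"
      "z - \<epsilon> = r * (2 * n\<^sup>2 - k)"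
    using assms(1) by (simp_all add: x y z k_def n_def field_simps power2_eq_square)
  have "\<epsilon> + x - z = x - (z - \<epsilon>)" by simp
  also have "\<dots> = r * ((1 + k) * (1 - 2 * n\<^sup>2))"
    unfolding eqs by (simp add: algebra_simps)
  finally have d: "\<epsilon> + x - z = r * ((1 + k) * (1 - 2 * n\<^sup>2))" .
  show ?thesis
    unfolding rho_den_def rho_num_def d unfolding eqs by algebra
qed

lemma rho_values_memI:
  assumes "rho_den \<epsilon> x y z > 0"
    and eq: "(2 * r - x)\<^sup>2 * rho_den \<epsilon> x y z = rho_num \<epsilon> x y z"
  shows "r \<in> rho_values \<epsilon> x y z"
proof -
  have "sqrt (rho_num \<epsilon> x y z) / sqrt (rho_den \<epsilon> x y z) = \<bar>2 * r - x\<bar>"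
    using assms(1) by (simp add: real_sqrt_mult flip: eq)
  moreover have "rho_num \<epsilon> x y z \<ge> 0"
    using assms(1) by (simp flip: eq)
  ultimately show ?thesis
    using assms(1) by (auto simp: rho_values_def abs_if field_simps)
qed

lemma m_values_memI:
  assumes "m\<^sup>2 - y * m + 2 * r * (r - x) = 0"
  shows "m \<in> m_values x y r"
proof -
  have eq: "- 8 * r\<^sup>2 + 8 * x * r + y\<^sup>2 = (2 * m - y)\<^sup>2"
    using assms by (simp add: power2_eq_square algebra_simps)
  show ?thesis
    unfolding m_values_def eq by (auto simp: abs_if field_simps)
qed

lemma projection_in_candidates:
  assumes eps: "\<epsilon> > 0"
    and notin: "(vector [x, y, z] :: real^3) \<notin> G_set \<epsilon>"
  shows "closest_point (G_set \<epsilon>) (vector [x, y, z]) \<in> candidates \<epsilon> x y z"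
proof -
  define p :: "real^3" where "p = closest_point (G_set \<epsilon>) (vector [x, y, z])"
  define r m where "r = p $ 1" and "m = p $ 2"
  from projection_kkt[OF eps, of "vector [x, y, z]"]
  obtain \<mu> \<nu> where r: "\<epsilon> \<le> r" and e: "\<epsilon> + m\<^sup>2 / (2 * r) \<le> p $ 3"
    and z: "p $ 3 - z = \<mu>" and mu0: "0 \<le> \<mu>"
    and surf: "0 < \<mu> \<Longrightarrow> p $ 3 = \<epsilon> + m\<^sup>2 / (2 * r)"
    and y: "m - y = - \<mu> * m / r"
    and x: "r - x = \<nu> + \<mu> * m\<^sup>2 / (2 * r\<^sup>2)" and nu0: "0 \<le> \<nu>" and nu: "\<epsilon> < r \<Longrightarrow> \<nu> = 0"
    by (auto simp: p_def r_def m_def vector_3)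
  have r0: "0 < r" using r eps by simp
  have p: "p = vector [r, m, p $ 3]"
    by (simp add: vec_eq_iff forall_3 vector_3 r_def m_def)
  show ?thesis
  proof (cases "\<mu> = 0")
    case True
    then have my: "m = y" and pz: "p $ 3 = z" using y z by auto
    have "\<nu> \<noteq> 0"
      using notin r e x True by (auto simp: vector3_in_G_set_iff my pz)
    with nu r have "r = \<epsilon>" by fastforce
    moreover have "x < \<epsilon>" using x True \<open>\<nu> \<noteq> 0\<close> nu0 \<open>r = \<epsilon>\<close> by simp
    ultimately have "p \<in> cand1 \<epsilon> x y z"
      using e p by (simp add: cand1_def my pz)
    then show ?thesis by (simp add: candidates_def p_def)
  next
    case False
    then have mu: "0 < \<mu>" using mu0 by simp
    note p3 = surf[OF mu]
    have p: "p = vector [r, m, \<epsilon> + m\<^sup>2 / (2 * r)]" using p p3 by simp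
    have zE: "z = \<epsilon> + m\<^sup>2 / (2 * r) - \<mu>" using z p3 by simp
    have yE: "y = m * (1 + \<mu> / r)" using y by (simp add: algebra_simps)
    show ?thesis
    proof (cases "y = 0")
      case True
      have "1 + \<mu> / r > 0" using mu r0 by (simp add: add_pos_pos)
      then have m: "m = 0" using True yE by simp
      have zlt: "z < \<epsilon>" and xr: "r - x = \<nu>" using zE x mu m by auto
      have "p \<in> cand2 \<epsilon> x y z \<union> cand4 \<epsilon> x y z"
      proof (cases "x < \<epsilon>")
        case True
        then have "r = \<epsilon>" using nu r xr by fastforce
        then show ?thesis using True \<open>y = 0\<close> zlt p m by (simp add: cand2_def)
      next
        case False
        then have "r = x" using nu r xr nu0 by fastforce
        then show ?thesis using False \<open>y = 0\<close> zlt p m by (simp add: cand4_def)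
      qed
      then show ?thesis by (auto simp: candidates_def p_def)
    next
      case y0: False
      then have m0: "m \<noteq> 0" using yE by auto
      have rel: "2 * r * (r - x - \<nu>) = m * (y - m)"
        using r0 by (simp add: x yE field_simps power2_eq_square)
      show ?thesis
      proof (cases "\<nu> = 0")
        case True
        have "rho_den \<epsilon> x y z > 0"
          using y0 by (simp add: rho_den_def add_pos_nonneg)
        moreover have "(2 * r - x)\<^sup>2 * rho_den \<epsilon> x y z = rho_num \<epsilon> x y z"
          using r0 x True yE zE
          by (intro kkt_rho_equation[where m = m and \<mu> = \<mu>]) (auto simp: algebra_simps)
        ultimately have "r \<in> rho_values \<epsilon> x y z" by (rule rho_values_memI)
        moreover have "m \<in> m_values x y r"
          using rel True by (intro m_values_memI) (simp add: algebra_simps power2_eq_square)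
        moreover have "\<epsilon> + m\<^sup>2 / (2 * r) > z" using zE mu by simp
        ultimately have "p \<in> cand5 \<epsilon> x y z"
          using p r unfolding cand5_def by blast
        then show ?thesis by (simp add: candidates_def p_def)
      next
        case False
        then have re: "r = \<epsilon>" and nup: "0 < \<nu>" using nu nu0 r by fastforce+
        have "y / m > 1" using m0 mu r0 by (simp add: yE)
        moreover have "m ^ 3 + (4 * \<epsilon>\<^sup>2 - 2 * \<epsilon> * z) * m - 2 * \<epsilon>\<^sup>2 * y = 0"
          using eps by (simp add: yE zE re field_simps power2_eq_square power3_eq_cube)
        moreover have "2 * \<epsilon> * x + m * (y - m) < 2 * \<epsilon>\<^sup>2"
        proof -
          have "0 < \<epsilon> * \<nu>" using eps nup by simp
          moreover have "2 * \<epsilon> * x + m * (y - m) = 2 * \<epsilon>\<^sup>2 - 2 * (\<epsilon> * \<nu>)"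
            using rel unfolding re by (simp add: algebra_simps power2_eq_square)
          ultimately show ?thesis by simp
        qed
        moreover have "p = vector [\<epsilon>, m, m\<^sup>2 / (2 * \<epsilon>) + \<epsilon>]"
          using p re by (simp add: add.commute)
        ultimately have "p \<in> cand3 \<epsilon> x y z"
          using y0 unfolding cand3_def by blast
        then show ?thesis by (simp add: candidates_def p_def)
      qed
    qed
  qed
qed

section \<open>The best candidate\<close>

lemma candidates_subset_G_set: "candidates \<epsilon> x y z \<subseteq> G_set \<epsilon>"
  unfolding candidates_def cand1_def cand2_def cand3_def cand4_def cand5_def
  by (auto simp: vector3_in_G_set_iff)

lemma sq_dist_eq_dist: "sq_dist x y z p = (dist (vector [x, y, z]) p)\<^sup>2"
  by (simp add: sq_dist_def dist_vec_def L2_set_def sum_3 vector_3 dist_real_def power2_commute)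

theorem mainTheorem2:
  fixes \<epsilon> x y z :: real
  assumes "\<epsilon> > 0"
    and "(vector [x, y, z] :: real^3) \<notin> G_set \<epsilon>"
  shows "(\<exists>p. is_arg_min (sq_dist x y z) (\<lambda>q. q \<in> candidates \<epsilon> x y z) p) \<and>
    (\<forall>p. is_arg_min (sq_dist x y z) (\<lambda>q. q \<in> candidates \<epsilon> x y z) p \<longrightarrow>
         p = closest_point (G_set \<epsilon>) (vector [x, y, z]))"
proof -
  let ?a = "vector [x, y, z] :: real^3"
  let ?c = "closest_point (G_set \<epsilon>) ?a"
  have c: "?c \<in> candidates \<epsilon> x y z"
    by (rule projection_in_candidates[OF assms])
  have closest: "dist ?a ?c \<le> dist ?a q" if "q \<in> G_set \<epsilon>" for q
    using closest_point_G_set_iff[OF assms(1), of ?c ?a] that by blast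
  have min_iff: "is_arg_min (sq_dist x y z) (\<lambda>q. q \<in> candidates \<epsilon> x y z) p \<longleftrightarrow>
      p \<in> candidates \<epsilon> x y z \<and> (\<forall>q\<in>candidates \<epsilon> x y z. dist ?a p \<le> dist ?a q)" for p
    by (auto simp: is_arg_min_linorder sq_dist_eq_dist)
  show ?thesis
  proof (intro conjI allI impI)
    show "\<exists>p. is_arg_min (sq_dist x y z) (\<lambda>q. q \<in> candidates \<epsilon> x y z) p"
      unfolding min_iff using c closest candidates_subset_G_set by blast
  next
    fix p assume "is_arg_min (sq_dist x y z) (\<lambda>q. q \<in> candidates \<epsilon> x y z) p"
    then have "p \<in> G_set \<epsilon>" and "dist ?a p \<le> dist ?a ?c"
      unfolding min_iff using c candidates_subset_G_set by blast+
    then show "p = ?c"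
      unfolding closest_point_G_set_iff[OF assms(1)] using closest by force
  qed
qed

end
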